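(* Let $a,b$ be positive integers, let $J$ be a metallic structure on a smooth manifold $M_n$ (that is, $J^2=aJ+bI$), with associated projectors $l,m$ and distributions $L,M$, let $\nabla$ be a linear connection on $M_n$, and let $\hat\nabla$ be the Vrănceanu connection of $(J,\nabla)$. If $[mX,lY]\in M$ for all $X\in M$ and $Y\in\chi(M_n)$, then the distribution $M$ is half parallel with respect to $\hat\nabla$.
   Context: All manifolds and tensor fields are $C^\infty$; $\chi(M_n)$ is the Lie algebra of vector fields on the $n$-dimensional manifold $M_n$ and $I$ is the identity; $X\in M$ means $X$ is a vector field that is a section of the distribution $M$. For positive integers $a,b$, a metallic structure is a $(1,1)$-tensor field $J$ with $J^2=aJ+bI$, and $\rho_{a,b}=\frac{a+\sqrt{a^2+4b}}{2}$. $L$ and $M$ are the complementary eigendistributions of $J$ for the eigenvalues $\rho_{a,b}$ and $a-\rho_{a,b}$ respectively, with projectors $l=\frac{1}{2\rho_{a,b}-a}J-\frac{a-\rho_{a,b}}{2\rho_{a,b}-a}I$ and $m=-\frac{1}{2\rho_{a,b}-a}J+\frac{\rho_{a,b}}{2\rho_{a,b}-a}I$. The Vrănceanu connection is $\hat\nabla_XY=l(\nabla_{lX}lY)+m(\nabla_{mX}mY)+l[mX,lY]+m[lX,mY]$. For a linear connection $D$ put $(\Delta J)(X,Y)=J D_XY-J D_YX-D_{JX}Y+D_Y(JX)$. The distribution $M$ is called half parallel with respect to $D$ if $(\Delta J)(X,Y)\in M$ for all $X\in M$, $Y\in\chi(M_n)$. *)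

theory Defs
  imports "HOL-Analysis.Analysis" "HOL-Library.Function_Algebras"
begin

subsection \<open>Smooth maps between open subsets of normed spaces\<close>

text \<open>Intended for open \<open>U\<close>.  On a finite-dimensional domain, \<open>Ck_on k f U\<close> says that all
  directional, hence all partial, derivatives of \<open>f\<close> of order at most \<open>k\<close> exist and are continuous
  on \<open>U\<close>.\<close>

primrec Ck_on ::
  "nat \<Rightarrow> ('e::real_normed_vector \<Rightarrow> 'f::real_normed_vector) \<Rightarrow> 'e set \<Rightarrow> bool" where
  "Ck_on 0 f U \<longleftrightarrow> continuous_on U f"
| "Ck_on (Suc k) f U \<longleftrightarrow> (\<forall>x\<in>U. f differentiable at x) \<and>
     (\<forall>v. Ck_on k (\<lambda>x. frechet_derivative f (at x) v) U)"

definition smooth_on ::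
  "('e::real_normed_vector \<Rightarrow> 'f::real_normed_vector) \<Rightarrow> 'e set \<Rightarrow> bool" where
  "smooth_on f U \<longleftrightarrow> (\<forall>k. Ck_on k f U)"

subsection \<open>Smooth manifolds\<close>

text \<open>The dimension is the cardinality of the index type \<open>'n\<close>.  A chart is a pair of its domain
  and the coordinate map; only the values of the latter on the domain matter.\<close>

record ('a, 'n::finite) manifold =
  mtop :: "'a topology"
  charts :: "('a set \<times> ('a \<Rightarrow> real ^ 'n)) set"

abbreviation points :: "('a, 'n::finite) manifold \<Rightarrow> 'a set" where
  "points M \<equiv> topspace (mtop M)"

definition smooth_manifold :: "('a, 'n::finite) manifold \<Rightarrow> bool" where
  "smooth_manifold M \<longleftrightarrow>
     Hausdorff_space (mtop M) \<and> second_countable (mtop M) \<and>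
     (\<forall>(U, \<phi>) \<in> charts M. openin (mtop M) U \<and> open (\<phi> ` U) \<and>
        homeomorphic_map (subtopology (mtop M) U) (top_of_set (\<phi> ` U)) \<phi>) \<and>
     (\<Union>(U, \<phi>) \<in> charts M. U) = points M \<and>
     (\<forall>(U, \<phi>) \<in> charts M. \<forall>(V, \<psi>) \<in> charts M.
        smooth_on (\<psi> \<circ> inv_into U \<phi>) (\<phi> ` (U \<inter> V)))"

text \<open>No condition is imposed outside \<open>points M\<close>.\<close>

definition smooth_fun :: "('a, 'n::finite) manifold \<Rightarrow> ('a \<Rightarrow> real) set" where
  "smooth_fun M = {f. \<forall>(U, \<phi>) \<in> charts M. smooth_on (f \<circ> inv_into U \<phi>) (\<phi> ` U)}"

subsection \<open>Tangent vectors and vector fields\<close>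

text \<open>Tangent vectors at \<open>p\<close> are the derivations at \<open>p\<close> of the algebra of smooth functions, extended
  by \<open>0\<close> to all functions.  The Leibniz rule implies that \<open>v f\<close> depends only on the restriction of
  \<open>f\<close> to \<open>points M\<close>.\<close>

type_synonym 'a tvector = "('a \<Rightarrow> real) \<Rightarrow> real"

definition scale :: "real \<Rightarrow> 'a tvector \<Rightarrow> 'a tvector" where
  "scale c v = (\<lambda>f. c * v f)"

definition tangent_space :: "('a, 'n::finite) manifold \<Rightarrow> 'a \<Rightarrow> 'a tvector set" where
  "tangent_space M p = {v.
     (\<forall>f\<in>smooth_fun M. \<forall>g\<in>smooth_fun M. v (\<lambda>q. f q + g q) = v f + v g) \<and>
     (\<forall>c. \<forall>f\<in>smooth_fun M. v (\<lambda>q. c * f q) = c * v f) \<and>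
     (\<forall>f\<in>smooth_fun M. \<forall>g\<in>smooth_fun M. v (\<lambda>q. f q * g q) = v f * g p + f p * v g) \<and>
     (\<forall>f. f \<notin> smooth_fun M \<longrightarrow> v f = 0)}"

type_synonym 'a vfield = "'a \<Rightarrow> 'a tvector"

text \<open>Setting fields to \<open>0\<close> outside \<open>points M\<close> makes equality of fields the right one.\<close>

definition vector_fields :: "('a, 'n::finite) manifold \<Rightarrow> 'a vfield set" where
  "vector_fields M = {X.
     (\<forall>p\<in>points M. X p \<in> tangent_space M p) \<and>
     (\<forall>p. p \<notin> points M \<longrightarrow> X p = 0) \<and>
     (\<forall>f\<in>smooth_fun M. (\<lambda>p. X p f) \<in> smooth_fun M)}"

definition scale_field :: "('a \<Rightarrow> real) \<Rightarrow> 'a vfield \<Rightarrow> 'a vfield" where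
  "scale_field f X = (\<lambda>p. scale (f p) (X p))"

definition lie_bracket :: "'a vfield \<Rightarrow> 'a vfield \<Rightarrow> 'a vfield" where
  "lie_bracket X Y = (\<lambda>p f. X p (\<lambda>q. Y q f) - Y p (\<lambda>q. X q f))"

subsection \<open>Tensor fields of type (1,1), distributions and linear connections\<close>

type_synonym 'a tensor11 = "'a \<Rightarrow> 'a tvector \<Rightarrow> 'a tvector"

definition apply_tensor ::
  "('a, 'n::finite) manifold \<Rightarrow> 'a tensor11 \<Rightarrow> 'a vfield \<Rightarrow> 'a vfield" where
  "apply_tensor M J X = (\<lambda>p. if p \<in> points M then J p (X p) else 0)"

definition tensor_field11 :: "('a, 'n::finite) manifold \<Rightarrow> 'a tensor11 \<Rightarrow> bool" where
  "tensor_field11 M J \<longleftrightarrow>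
     (\<forall>p\<in>points M. \<forall>v\<in>tangent_space M p. J p v \<in> tangent_space M p) \<and>
     (\<forall>p\<in>points M. \<forall>v\<in>tangent_space M p. \<forall>w\<in>tangent_space M p. J p (v + w) = J p v + J p w) \<and>
     (\<forall>p\<in>points M. \<forall>c. \<forall>v\<in>tangent_space M p. J p (scale c v) = scale c (J p v)) \<and>
     (\<forall>X\<in>vector_fields M. apply_tensor M J X \<in> vector_fields M)"

definition eigen_distribution ::
  "('a, 'n::finite) manifold \<Rightarrow> 'a tensor11 \<Rightarrow> real \<Rightarrow> 'a \<Rightarrow> 'a tvector set" where
  "eigen_distribution M J c p = {v \<in> tangent_space M p. J p v = scale c v}"

definition dist_sections ::
  "('a, 'n::finite) manifold \<Rightarrow> ('a \<Rightarrow> 'a tvector set) \<Rightarrow> 'a vfield set" where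
  "dist_sections M D = {X \<in> vector_fields M. \<forall>p\<in>points M. X p \<in> D p}"

type_synonym 'a connection = "'a vfield \<Rightarrow> 'a vfield \<Rightarrow> 'a vfield"

definition linear_connection :: "('a, 'n::finite) manifold \<Rightarrow> 'a connection \<Rightarrow> bool" where
  "linear_connection M D \<longleftrightarrow>
     (\<forall>X\<in>vector_fields M. \<forall>Y\<in>vector_fields M. D X Y \<in> vector_fields M) \<and>
     (\<forall>X\<in>vector_fields M. \<forall>X'\<in>vector_fields M. \<forall>Y\<in>vector_fields M.
        D (X + X') Y = D X Y + D X' Y) \<and>
     (\<forall>f\<in>smooth_fun M. \<forall>X\<in>vector_fields M. \<forall>Y\<in>vector_fields M.
        D (scale_field f X) Y = scale_field f (D X Y)) \<and>
     (\<forall>X\<in>vector_fields M. \<forall>Y\<in>vector_fields M. \<forall>Y'\<in>vector_fields M.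
        D X (Y + Y') = D X Y + D X Y') \<and>
     (\<forall>f\<in>smooth_fun M. \<forall>X\<in>vector_fields M. \<forall>Y\<in>vector_fields M.
        D X (scale_field f Y) = scale_field (\<lambda>p. X p f) Y + scale_field f (D X Y))"

subsection \<open>Metallic structures\<close>

definition metallic_structure ::
  "('a, 'n::finite) manifold \<Rightarrow> nat \<Rightarrow> nat \<Rightarrow> 'a tensor11 \<Rightarrow> bool" where
  "metallic_structure M a b J \<longleftrightarrow> tensor_field11 M J \<and>
     (\<forall>p\<in>points M. \<forall>v\<in>tangent_space M p.
        J p (J p v) = scale (real a) (J p v) + scale (real b) v)"

definition metallic_mean :: "nat \<Rightarrow> nat \<Rightarrow> real" where
  "metallic_mean a b = (real a + sqrt ((real a)\<^sup>2 + 4 * real b)) / 2"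

definition proj_l :: "nat \<Rightarrow> nat \<Rightarrow> 'a tensor11 \<Rightarrow> 'a tensor11" where
  "proj_l a b J = (\<lambda>p v. let \<rho> = metallic_mean a b in
     scale (1 / (2 * \<rho> - real a)) (J p v) - scale ((real a - \<rho>) / (2 * \<rho> - real a)) v)"

definition proj_m :: "nat \<Rightarrow> nat \<Rightarrow> 'a tensor11 \<Rightarrow> 'a tensor11" where
  "proj_m a b J = (\<lambda>p v. let \<rho> = metallic_mean a b in
     scale (- (1 / (2 * \<rho> - real a))) (J p v) + scale (\<rho> / (2 * \<rho> - real a)) v)"

definition dist_L ::
  "('a, 'n::finite) manifold \<Rightarrow> nat \<Rightarrow> nat \<Rightarrow> 'a tensor11 \<Rightarrow> 'a \<Rightarrow> 'a tvector set" where
  "dist_L M a b J = eigen_distribution M J (metallic_mean a b)"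

definition dist_M ::
  "('a, 'n::finite) manifold \<Rightarrow> nat \<Rightarrow> nat \<Rightarrow> 'a tensor11 \<Rightarrow> 'a \<Rightarrow> 'a tvector set" where
  "dist_M M a b J = eigen_distribution M J (real a - metallic_mean a b)"

definition vranceanu_connection ::
  "('a, 'n::finite) manifold \<Rightarrow> nat \<Rightarrow> nat \<Rightarrow> 'a tensor11 \<Rightarrow> 'a connection \<Rightarrow> 'a connection" where
  "vranceanu_connection M a b J D = (\<lambda>X Y.
     let l = apply_tensor M (proj_l a b J); m = apply_tensor M (proj_m a b J) in
       l (D (l X) (l Y)) + m (D (m X) (m Y))
       + l (lie_bracket (m X) (l Y)) + m (lie_bracket (l X) (m Y)))"

definition Delta ::
  "('a, 'n::finite) manifold \<Rightarrow> 'a tensor11 \<Rightarrow> 'a connection \<Rightarrow> 'a vfield \<Rightarrow> 'a vfield \<Rightarrow> 'a vfield" where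
  "Delta M J D X Y = (let J' = apply_tensor M J in
     J' (D X Y) - J' (D Y X) - D (J' X) Y + D Y (J' X))"

definition half_parallel ::
  "('a, 'n::finite) manifold \<Rightarrow> 'a tensor11 \<Rightarrow> 'a connection \<Rightarrow> ('a \<Rightarrow> 'a tvector set) \<Rightarrow> bool" where
  "half_parallel M J D E \<longleftrightarrow>
     (\<forall>X\<in>dist_sections M E. \<forall>Y\<in>vector_fields M. Delta M J D X Y \<in> dist_sections M E)"

end

theory Submission
  imports Defs
begin

text \<open>
  Write \<open>\<mu> = a - \<rho>\<close> for the eigenvalue of \<open>J\<close> on \<open>M\<close>.  If \<open>X\<close> is a section of \<open>M\<close> then
  \<open>l X = 0\<close> and \<open>m X = X\<close>, so two of the four terms of the Vranceanu connection disappear: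
  \<open>\<nabla>\<^sub>X Y\<close> becomes \<open>m (\<nabla>\<^sub>X (m Y)) + l [X, l Y]\<close>, where the
  hypothesis kills the second summand, and \<open>\<nabla>\<^sub>Y X\<close> becomes
  \<open>m (\<nabla>\<^bsub>m Y\<^esub> X) + m [l Y, X]\<close>.  Both are values of \<open>m\<close>, hence sections of \<open>M\<close>
  (\<open>vranceanu_left_section\<close>, \<open>vranceanu_right_section\<close>).  Since \<open>J\<close> maps sections of \<open>M\<close> to
  sections of \<open>M\<close>, each of the four terms of \<open>\<Delta>J (X, Y)\<close> is a section of \<open>M\<close>.

  Sections of \<open>M\<close> are by definition smooth, so each of these terms must be recognised as a smooth
  vector field.  This rests on the fact that smooth functions, and therefore vector fields, form
  a real vector space.  For the term \<open>[l Y, X] = - [X, l Y]\<close> smoothness comes from the hypothesis on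
  \<open>M\<close> itself, so that the Leibniz rule for iterated derivations never enters.
\<close>

section \<open>Linear combinations of smooth functions and of vector fields\<close>

text \<open>The function \<open>h\<close> need only agree with the combination on \<open>U\<close>: in the induction step it stands
  for the derivative of the previous \<open>h\<close>, which is known by a formula on \<open>U\<close> alone.\<close>

lemma Ck_on_linear_combination:
  fixes f g h :: "'e::real_normed_vector \<Rightarrow> 'f::real_normed_vector"
  assumes "open U" "Ck_on k f U" "Ck_on k g U"
    and "\<And>x. x \<in> U \<Longrightarrow> h x = c *\<^sub>R f x + d *\<^sub>R g x"
  shows "Ck_on k h U"
  using assms(2-)
proof (induction k arbitrary: f g h)
  case 0
  have "continuous_on U (\<lambda>x. c *\<^sub>R f x + d *\<^sub>R g x)"
    using 0 by (auto intro!: continuous_intros)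
  then show ?case
    using 0(3) by (simp cong: continuous_on_cong)
next
  case (Suc k)
  have der: "(h has_derivative
      (\<lambda>v. c *\<^sub>R frechet_derivative f (at x) v + d *\<^sub>R frechet_derivative g (at x) v)) (at x)"
    if "x \<in> U" for x
  proof (rule has_derivative_transform_within_open[OF _ \<open>open U\<close> that])
    have "(f has_derivative frechet_derivative f (at x)) (at x)"
      "(g has_derivative frechet_derivative g (at x)) (at x)"
      using Suc.prems that by (auto simp: frechet_derivative_works)
    then show "((\<lambda>x. c *\<^sub>R f x + d *\<^sub>R g x) has_derivative
      (\<lambda>v. c *\<^sub>R frechet_derivative f (at x) v + d *\<^sub>R frechet_derivative g (at x) v)) (at x)"
      by (auto intro!: derivative_intros)
  qed (simp add: Suc.prems)
  have "Ck_on k (\<lambda>x. frechet_derivative h (at x) v) U" for v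
  proof (rule Suc.IH)
    show "Ck_on k (\<lambda>x. frechet_derivative f (at x) v) U"
      "Ck_on k (\<lambda>x. frechet_derivative g (at x) v) U"
      using Suc.prems by auto
  qed (simp add: frechet_derivative_at[OF der, symmetric])
  then show ?case
    using der by (auto simp: differentiable_def)
qed

lemma smooth_fun_linear_combination:
  assumes "smooth_manifold M" "f \<in> smooth_fun M" "g \<in> smooth_fun M"
  shows "(\<lambda>q. c * f q + d * g q) \<in> smooth_fun M"
  unfolding smooth_fun_def
proof clarify
  fix U \<phi>
  assume chart: "(U, \<phi>) \<in> charts M"
  then have "open (\<phi> ` U)"
    using assms(1) by (auto simp: smooth_manifold_def)
  moreover have "smooth_on (f \<circ> inv_into U \<phi>) (\<phi> ` U)" "smooth_on (g \<circ> inv_into U \<phi>) (\<phi> ` U)"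
    using assms(2,3) chart by (auto simp: smooth_fun_def)
  ultimately show "smooth_on ((\<lambda>q. c * f q + d * g q) \<circ> inv_into U \<phi>) (\<phi> ` U)"
    unfolding smooth_on_def by (auto intro: Ck_on_linear_combination[where c = c and d = d])
qed

lemma tangent_space_linear_combination:
  assumes "v \<in> tangent_space M p" "w \<in> tangent_space M p"
  shows "scale c v + scale d w \<in> tangent_space M p"
  using assms by (auto simp: tangent_space_def scale_def algebra_simps)

lemma tangent_space_scale:
  assumes "v \<in> tangent_space M p"
  shows "scale c v \<in> tangent_space M p"
proof -
  have "scale c v = scale c v + scale 0 v"
    by (simp add: scale_def fun_eq_iff)
  then show ?thesis
    using tangent_space_linear_combination[OF assms assms] by metis
qed

lemma scale_zero_right [simp]: "scale c 0 = 0"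
  by (simp add: scale_def fun_eq_iff)

lemma vector_fields_linear_combination:
  assumes "smooth_manifold M" "X \<in> vector_fields M" "Y \<in> vector_fields M"
  shows "(\<lambda>p. scale c (X p) + scale d (Y p)) \<in> vector_fields M"
proof -
  have "(\<lambda>p. c * X p f + d * Y p f) \<in> smooth_fun M" if "f \<in> smooth_fun M" for f
    using assms that by (intro smooth_fun_linear_combination) (auto simp: vector_fields_def)
  then have "(\<lambda>p. (scale c (X p) + scale d (Y p)) f) \<in> smooth_fun M" if "f \<in> smooth_fun M" for f
    using that by (simp add: scale_def)
  then show ?thesis
    using assms(2,3)
    by (simp add: vector_fields_def tangent_space_linear_combination)
qed

lemma vector_fields_add:
  assumes "smooth_manifold M" "X \<in> vector_fields M" "Y \<in> vector_fields M"
  shows "X + Y \<in> vector_fields M"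
proof -
  have "X + Y = (\<lambda>p. scale 1 (X p) + scale 1 (Y p))"
    by (simp add: scale_def fun_eq_iff)
  then show ?thesis
    using vector_fields_linear_combination[OF assms] by simp
qed

lemma vector_fields_diff:
  assumes "smooth_manifold M" "X \<in> vector_fields M" "Y \<in> vector_fields M"
  shows "X - Y \<in> vector_fields M"
proof -
  have "X - Y = (\<lambda>p. scale 1 (X p) + scale (- 1) (Y p))"
    by (simp add: scale_def fun_eq_iff)
  then show ?thesis
    using vector_fields_linear_combination[OF assms] by simp
qed

section \<open>Degenerate arguments of brackets and connections\<close>

text \<open>Whether or not the zero function is smooth, a tangent vector kills it: by homogeneity in the
  first case, by convention in the second.\<close>

lemma tangent_vector_zero_function:
  assumes "v \<in> tangent_space M p"
  shows "v (\<lambda>q. 0) = 0"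
proof (cases "(\<lambda>q. 0) \<in> smooth_fun M")
  case True
  have "\<forall>c. \<forall>f\<in>smooth_fun M. v (\<lambda>q. c * f q) = c * v f"
    using assms by (simp add: tangent_space_def)
  from this[rule_format, OF True, of 0] show ?thesis by simp
next
  case False
  then show ?thesis
    using assms by (auto simp: tangent_space_def)
qed

lemma vector_field_zero_function:
  assumes "X \<in> vector_fields M"
  shows "X p (\<lambda>q. 0) = 0"
  using assms tangent_vector_zero_function[of "X p" M p]
  by (cases "p \<in> points M") (auto simp: vector_fields_def)

lemma lie_bracket_zero_right:
  assumes "X \<in> vector_fields M"
  shows "lie_bracket X 0 = 0"
  using vector_field_zero_function[OF assms] by (simp add: lie_bracket_def fun_eq_iff)

lemma lie_bracket_zero_left:
  assumes "X \<in> vector_fields M"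
  shows "lie_bracket 0 X = 0"
  using vector_field_zero_function[OF assms] by (simp add: lie_bracket_def fun_eq_iff)

text \<open>The negative is written as a difference from \<open>0\<close> because sections of \<open>M\<close> are
  closed under differences.\<close>

lemma lie_bracket_antisym: "lie_bracket X Y = 0 - lie_bracket Y X"
  by (simp add: lie_bracket_def fun_eq_iff)

lemma zero_vector_field:
  assumes "smooth_manifold M" "X \<in> vector_fields M"
  shows "0 \<in> vector_fields M"
  using vector_fields_diff[OF assms assms(2)] by simp

lemma linear_connection_zero_left:
  assumes "linear_connection M D" "0 \<in> vector_fields M" "Y \<in> vector_fields M"
  shows "D 0 Y = 0"
proof -
  have "D (0 + 0) Y = D 0 Y + D 0 Y"
    using assms unfolding linear_connection_def by blast
  then show ?thesis by simp
qed

lemma linear_connection_zero_right: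
  assumes "linear_connection M D" "0 \<in> vector_fields M" "X \<in> vector_fields M"
  shows "D X 0 = 0"
proof -
  have "D X (0 + 0) = D X 0 + D X 0"
    using assms unfolding linear_connection_def by blast
  then show ?thesis by simp
qed

section \<open>The projectors of a metallic structure\<close>

lemma metallic_mean_discriminant_neq_0:
  assumes "b > 0"
  shows "2 * metallic_mean a b - real a \<noteq> 0"
proof -
  have "sqrt ((real a)\<^sup>2 + 4 * real b) > 0"
    using assms by (simp add: add_nonneg_pos)
  then show ?thesis
    by (simp add: metallic_mean_def)
qed

lemma metallic_mean_conjugate_product:
  "(real a - metallic_mean a b) * metallic_mean a b = - real b"
proof -
  define s where "s = sqrt ((real a)\<^sup>2 + 4 * real b)"
  have "s * s = (real a)\<^sup>2 + 4 * real b"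
    by (simp add: s_def)
  then show ?thesis
    unfolding metallic_mean_def s_def[symmetric] by (simp add: field_simps power2_eq_square)
qed

lemma proj_l_vanishes_on_dist_M:
  assumes "v \<in> dist_M M a b J p"
  shows "proj_l a b J p v = 0"
  using assms
  by (simp add: dist_M_def eigen_distribution_def proj_l_def Let_def scale_def fun_eq_iff)

lemma proj_m_fixes_dist_M:
  assumes "b > 0" "v \<in> dist_M M a b J p"
  shows "proj_m a b J p v = v"
proof -
  define \<rho> where "\<rho> = metallic_mean a b"
  define \<delta> where "\<delta> = 2 * \<rho> - real a"
  have "\<delta> \<noteq> 0"
    using metallic_mean_discriminant_neq_0[OF assms(1)] by (simp add: \<rho>_def \<delta>_def)
  moreover have "J p v = scale (\<rho> - \<delta>) v"
    using assms(2) by (simp add: dist_M_def eigen_distribution_def \<rho>_def \<delta>_def)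
  ultimately show ?thesis
    unfolding proj_m_def Let_def \<rho>_def[symmetric] \<delta>_def[symmetric]
    by (simp add: scale_def fun_eq_iff field_simps)
qed

text \<open>Additivity of \<open>J\<close> at a point holds on tangent vectors only, so both multiples must first be
  known to be tangent.\<close>

lemma tensor_linear_combination:
  assumes "tensor_field11 M J" "p \<in> points M" "v \<in> tangent_space M p" "w \<in> tangent_space M p"
  shows "J p (scale c v + scale d w) = scale c (J p v) + scale d (J p w)"
proof -
  have "J p (scale c v + scale d w) = J p (scale c v) + J p (scale d w)"
    using assms by (simp add: tensor_field11_def tangent_space_scale)
  then show ?thesis
    using assms by (simp add: tensor_field11_def)
qed

text \<open>This is the factorisation \<open>J\<^sup>2 - a J - b I = (J - \<mu> I) (J - \<rho> I)\<close> with \<open>\<mu> = a - \<rho>\<close>: up to a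
  factor, \<open>m\<close> is \<open>J - \<rho> I\<close>, so its image is killed by \<open>J - \<mu> I\<close>.\<close>

lemma proj_m_in_dist_M:
  assumes "metallic_structure M a b J" "p \<in> points M" "v \<in> tangent_space M p"
  shows "proj_m a b J p v \<in> dist_M M a b J p"
proof -
  define \<rho> where "\<rho> = metallic_mean a b"
  define c where "c = 1 / (2 * \<rho> - real a)"
  have tensor: "tensor_field11 M J"
    using assms(1) by (simp add: metallic_structure_def)
  have Jv: "J p v \<in> tangent_space M p"
    using tensor assms(2,3) by (simp add: tensor_field11_def)
  have m: "proj_m a b J p v = scale (- c) (J p v) + scale (\<rho> * c) v"
    by (simp add: proj_m_def Let_def \<rho>_def c_def)
  have quadratic: "J p (J p v) = scale (real a) (J p v) + scale (real b) v"
    using assms by (simp add: metallic_structure_def)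
  have conj_prod: "real b = - ((real a - \<rho>) * \<rho>)"
    using metallic_mean_conjugate_product[of a b] by (simp add: \<rho>_def)
  have "J p (proj_m a b J p v) = scale (- c) (J p (J p v)) + scale (\<rho> * c) (J p v)"
    unfolding m by (rule tensor_linear_combination[OF tensor assms(2) Jv assms(3)])
  also have "\<dots> = scale (real a - \<rho>) (proj_m a b J p v)"
    unfolding quadratic m by (simp add: conj_prod scale_def fun_eq_iff algebra_simps)
  finally show ?thesis
    using tangent_space_linear_combination[OF Jv assms(3)]
    by (simp add: dist_M_def eigen_distribution_def \<rho>_def m)
qed

lemma apply_proj_l_vector_field:
  assumes "smooth_manifold M" "tensor_field11 M J" "X \<in> vector_fields M"
  shows "apply_tensor M (proj_l a b J) X \<in> vector_fields M"
proof -
  define \<rho> where "\<rho> = metallic_mean a b"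
  have outside: "X p = 0" if "p \<notin> points M" for p
    using assms(3) that by (simp add: vector_fields_def)
  have "apply_tensor M (proj_l a b J) X = (\<lambda>p. scale (1 / (2 * \<rho> - real a)) (apply_tensor M J X p)
      + scale (- ((real a - \<rho>) / (2 * \<rho> - real a))) (X p))"
    by (auto simp: apply_tensor_def proj_l_def Let_def \<rho>_def outside scale_def fun_eq_iff)
  moreover have "apply_tensor M J X \<in> vector_fields M"
    using assms(2,3) by (simp add: tensor_field11_def)
  ultimately show ?thesis
    using vector_fields_linear_combination[OF assms(1) _ assms(3)] by simp
qed

lemma apply_proj_m_vector_field:
  assumes "smooth_manifold M" "tensor_field11 M J" "X \<in> vector_fields M"
  shows "apply_tensor M (proj_m a b J) X \<in> vector_fields M"
proof -
  define \<rho> where "\<rho> = metallic_mean a b"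
  have outside: "X p = 0" if "p \<notin> points M" for p
    using assms(3) that by (simp add: vector_fields_def)
  have "apply_tensor M (proj_m a b J) X =
      (\<lambda>p. scale (- (1 / (2 * \<rho> - real a))) (apply_tensor M J X p)
      + scale (\<rho> / (2 * \<rho> - real a)) (X p))"
    by (auto simp: apply_tensor_def proj_m_def Let_def \<rho>_def outside scale_def fun_eq_iff)
  moreover have "apply_tensor M J X \<in> vector_fields M"
    using assms(2,3) by (simp add: tensor_field11_def)
  ultimately show ?thesis
    using vector_fields_linear_combination[OF assms(1) _ assms(3)] by simp
qed

section \<open>Sections of the second eigendistribution\<close>

lemma apply_proj_m_section:
  assumes "smooth_manifold M" "metallic_structure M a b J" "X \<in> vector_fields M"
  shows "apply_tensor M (proj_m a b J) X \<in> dist_sections M (dist_M M a b J)"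
proof -
  have "tensor_field11 M J"
    using assms(2) by (simp add: metallic_structure_def)
  then show ?thesis
    using apply_proj_m_vector_field[OF assms(1) _ assms(3)] proj_m_in_dist_M[OF assms(2)] assms(3)
    by (simp add: dist_sections_def apply_tensor_def vector_fields_def)
qed

lemma apply_proj_m_of_section:
  assumes "b > 0" "X \<in> dist_sections M (dist_M M a b J)"
  shows "apply_tensor M (proj_m a b J) X = X"
proof (rule ext)
  fix p
  show "apply_tensor M (proj_m a b J) X p = X p"
    using assms proj_m_fixes_dist_M[OF assms(1), of "X p" M a J p]
    by (simp add: apply_tensor_def dist_sections_def vector_fields_def)
qed

lemma apply_proj_l_of_section:
  assumes "X \<in> dist_sections M (dist_M M a b J)"
  shows "apply_tensor M (proj_l a b J) X = 0"
proof (rule ext)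
  fix p
  show "apply_tensor M (proj_l a b J) X p = 0 p"
    using assms proj_l_vanishes_on_dist_M[of "X p" M a b J p]
    by (simp add: apply_tensor_def dist_sections_def)
qed

lemma dist_M_linear_combination:
  assumes "tensor_field11 M J" "p \<in> points M"
    and "v \<in> dist_M M a b J p" "w \<in> dist_M M a b J p"
  shows "scale c v + scale d w \<in> dist_M M a b J p"
proof -
  define \<mu> where "\<mu> = real a - metallic_mean a b"
  have vw: "v \<in> tangent_space M p" "w \<in> tangent_space M p"
    "J p v = scale \<mu> v" "J p w = scale \<mu> w"
    using assms(3,4) by (auto simp: dist_M_def eigen_distribution_def \<mu>_def)
  have "J p (scale c v + scale d w) = scale \<mu> (scale c v + scale d w)"
    unfolding tensor_linear_combination[OF assms(1,2) vw(1,2)] vw(3,4)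
    by (simp add: scale_def fun_eq_iff algebra_simps)
  then show ?thesis
    using tangent_space_linear_combination[OF vw(1,2)]
    by (simp add: dist_M_def eigen_distribution_def \<mu>_def)
qed

lemma dist_M_sections_add:
  assumes "smooth_manifold M" "tensor_field11 M J"
    and "X \<in> dist_sections M (dist_M M a b J)" "Y \<in> dist_sections M (dist_M M a b J)"
  shows "X + Y \<in> dist_sections M (dist_M M a b J)"
proof -
  have "X p + Y p \<in> dist_M M a b J p" if "p \<in> points M" for p
    using dist_M_linear_combination[OF assms(2) that, of "X p" a b "Y p" 1 1] assms(3,4) that
    by (simp add: dist_sections_def scale_def)
  then show ?thesis
    using vector_fields_add[OF assms(1)] assms(3,4) by (simp add: dist_sections_def)
qed

lemma dist_M_sections_diff:
  assumes "smooth_manifold M" "tensor_field11 M J"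
    and "X \<in> dist_sections M (dist_M M a b J)" "Y \<in> dist_sections M (dist_M M a b J)"
  shows "X - Y \<in> dist_sections M (dist_M M a b J)"
proof -
  have "X p - Y p \<in> dist_M M a b J p" if "p \<in> points M" for p
  proof -
    have "X p - Y p = scale 1 (X p) + scale (- 1) (Y p)"
      by (simp add: scale_def fun_eq_iff)
    then show ?thesis
      using dist_M_linear_combination[OF assms(2) that, of "X p" a b "Y p" 1 "- 1"] assms(3,4) that
      by (simp add: dist_sections_def)
  qed
  then show ?thesis
    using vector_fields_diff[OF assms(1)] assms(3,4) by (simp add: dist_sections_def)
qed

lemma zero_dist_M_section:
  assumes "smooth_manifold M" "tensor_field11 M J" "X \<in> dist_sections M (dist_M M a b J)"
  shows "0 \<in> dist_sections M (dist_M M a b J)"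
  using dist_M_sections_diff[OF assms assms(3)] by simp

lemma dist_M_sections_invariant:
  assumes "tensor_field11 M J" "X \<in> dist_sections M (dist_M M a b J)"
  shows "apply_tensor M J X \<in> dist_sections M (dist_M M a b J)"
  using assms
  by (auto simp: dist_sections_def dist_M_def eigen_distribution_def apply_tensor_def
      tensor_field11_def tangent_space_scale)

section \<open>Vranceanu derivatives involving a section\<close>

text \<open>As \<open>l X = 0\<close> and \<open>m X = X\<close>, only \<open>m (\<nabla>\<^sub>X (m Y)) + l [X, l Y]\<close> is left.  Its
  second summand is the component of \<open>[X, l Y]\<close> in \<open>L\<close>, which is what the bracket hypothesis
  annihilates.\<close>

lemma vranceanu_left_section:
  assumes "b > 0" "smooth_manifold M" "metallic_structure M a b J" "linear_connection M D"
    and X: "X \<in> dist_sections M (dist_M M a b J)" and Y: "Y \<in> vector_fields M"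
    and bracket: "lie_bracket (apply_tensor M (proj_m a b J) X) (apply_tensor M (proj_l a b J) Y)
             \<in> dist_sections M (dist_M M a b J)"
  shows "vranceanu_connection M a b J D X Y \<in> dist_sections M (dist_M M a b J)"
proof -
  let ?l = "apply_tensor M (proj_l a b J)" and ?m = "apply_tensor M (proj_m a b J)"
  have tensor: "tensor_field11 M J"
    using assms(3) by (simp add: metallic_structure_def)
  have XV: "X \<in> vector_fields M"
    using X by (simp add: dist_sections_def)
  have zero: "0 \<in> dist_sections M (dist_M M a b J)"
    using zero_dist_M_section[OF assms(2) tensor X] .
  have lY: "?l Y \<in> vector_fields M" and mY: "?m Y \<in> vector_fields M"
    using apply_proj_l_vector_field apply_proj_m_vector_field assms(2) tensor Y by blast+
  have "D 0 (?l Y) = 0"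
    using linear_connection_zero_left[OF assms(4) zero_vector_field[OF assms(2) Y] lY] .
  then have "vranceanu_connection M a b J D X Y = ?m (D X (?m Y))"
    using apply_proj_l_of_section[OF X] apply_proj_m_of_section[OF assms(1) X]
      apply_proj_l_of_section[OF zero] apply_proj_m_of_section[OF assms(1) zero]
      apply_proj_l_of_section[OF bracket] lie_bracket_zero_left[OF mY]
    by (simp add: vranceanu_connection_def Let_def)
  moreover have "D X (?m Y) \<in> vector_fields M"
    using assms(4) XV mY by (simp add: linear_connection_def)
  ultimately show ?thesis
    using apply_proj_m_section[OF assms(2,3)] by simp
qed

text \<open>What remains of the derivative is \<open>m (\<nabla>\<^bsub>m Y\<^esub> X) + m [l Y, X]\<close>, a value of \<open>m\<close>.  The
  bracket hypothesis serves only to make \<open>[l Y, X]\<close> a smooth vector field.\<close>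

lemma vranceanu_right_section:
  assumes "b > 0" "smooth_manifold M" "metallic_structure M a b J" "linear_connection M D"
    and X: "X \<in> dist_sections M (dist_M M a b J)" and Y: "Y \<in> vector_fields M"
    and bracket: "lie_bracket (apply_tensor M (proj_m a b J) X) (apply_tensor M (proj_l a b J) Y)
             \<in> dist_sections M (dist_M M a b J)"
  shows "vranceanu_connection M a b J D Y X \<in> dist_sections M (dist_M M a b J)"
proof -
  let ?l = "apply_tensor M (proj_l a b J)" and ?m = "apply_tensor M (proj_m a b J)"
  have tensor: "tensor_field11 M J"
    using assms(3) by (simp add: metallic_structure_def)
  have XV: "X \<in> vector_fields M"
    using X by (simp add: dist_sections_def)
  have zero: "0 \<in> dist_sections M (dist_M M a b J)"
    using zero_dist_M_section[OF assms(2) tensor X] .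
  have lY: "?l Y \<in> vector_fields M" and mY: "?m Y \<in> vector_fields M"
    using apply_proj_l_vector_field apply_proj_m_vector_field assms(2) tensor Y by blast+
  have swapped: "lie_bracket (?l Y) (?m X) \<in> dist_sections M (dist_M M a b J)"
    using dist_M_sections_diff[OF assms(2) tensor zero bracket]
    by (subst lie_bracket_antisym)
  have "D (?l Y) 0 = 0"
    using linear_connection_zero_right[OF assms(4) zero_vector_field[OF assms(2) Y] lY] .
  then have "vranceanu_connection M a b J D Y X = ?m (D (?m Y) X) + lie_bracket (?l Y) (?m X)"
    using apply_proj_l_of_section[OF X] apply_proj_m_of_section[OF assms(1) X]
      apply_proj_l_of_section[OF zero] apply_proj_m_of_section[OF assms(1) swapped]
      lie_bracket_zero_right[OF mY]
    by (simp add: vranceanu_connection_def Let_def)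
  moreover have "D (?m Y) X \<in> vector_fields M"
    using assms(4) XV mY by (simp add: linear_connection_def)
  ultimately show ?thesis
    using dist_M_sections_add[OF assms(2) tensor apply_proj_m_section[OF assms(2,3)] swapped]
    by simp
qed

section \<open>Half parallelism\<close>

theorem proposition17:
  fixes a b :: nat
    and M :: "('a, 'n::finite) manifold"
    and J :: "'a tensor11"
    and nabla :: "'a connection"
  assumes "a > 0" and "b > 0"
    and "smooth_manifold M"
    and "metallic_structure M a b J"
    and "linear_connection M nabla"
    and "\<forall>X \<in> dist_sections M (dist_M M a b J). \<forall>Y \<in> vector_fields M.
           lie_bracket (apply_tensor M (proj_m a b J) X) (apply_tensor M (proj_l a b J) Y)
             \<in> dist_sections M (dist_M M a b J)"
  shows "half_parallel M J (vranceanu_connection M a b J nabla) (dist_M M a b J)"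
  unfolding half_parallel_def
proof (intro ballI)
  fix X Y
  assume X: "X \<in> dist_sections M (dist_M M a b J)" and Y: "Y \<in> vector_fields M"
  let ?S = "dist_sections M (dist_M M a b J)" and ?D = "vranceanu_connection M a b J nabla"
  have tensor: "tensor_field11 M J"
    using assms(4) by (simp add: metallic_structure_def)
  have left: "?D Z Y \<in> ?S" and right: "?D Y Z \<in> ?S" if "Z \<in> ?S" for Z
    using vranceanu_left_section[OF assms(2-5) that Y] vranceanu_right_section[OF assms(2-5) that Y]
      assms(6) that Y by blast+
  note invariant = dist_M_sections_invariant[OF tensor]
  show "Delta M J ?D X Y \<in> ?S"
    unfolding Delta_def Let_def
    by (intro dist_M_sections_add[OF assms(3) tensor] dist_M_sections_diff[OF assms(3) tensor]
        left right invariant X)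
qed

end
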